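(* Let $x_1,x_2$ be linearly independent unit vectors of $\mathbb R^3$. The rotation of $\mathbb R^3$ about the origin in the plane spanned by $x_1,x_2$, with angle $2\angle(x_1,x_2)$ (in the sense of rotation from $x_1$ toward $x_2$), is induced by the composition of the four reflections in $\mathbb R^{3,3}$ with respect to the following invertible vectors, applied sequentially from right to left: $$\begin{pmatrix} x_2 \\ -x_2 \end{pmatrix},\quad \begin{pmatrix} x_2 \\ x_2 \end{pmatrix},\quad \begin{pmatrix} x_1 \\ -x_1 \end{pmatrix},\quad \begin{pmatrix} x_1 \\ x_1 \end{pmatrix}.$$
   Context: Let $e_0,e_1,e_2,e_3$ be the standard orthonormal basis of $\mathbb R^4$ and identify $\mathbb R^3=\mathrm{span}(e_1,e_2,e_3)$. $\mathbb R^{3,3}=\Lambda^2(\mathbb R^4)$ has basis $E_i=e_0\wedge e_i$ ($i=1,2,3$), $E_1'=e_2\wedge e_3$, $E_2'=e_3\wedge e_1$, $E_3'=e_1\wedge e_2$ and symmetric bilinear form $E_i\cdot E_j'=\delta_{ij}$, $E_i\cdot E_j=E_i'\cdot E_j'=0$. For $x,y\in\mathbb R^3$, $\begin{pmatrix} x \\ y \end{pmatrix}$ denotes the vector $\sum_i x_iE_i+\sum_i y_iE_i'$ of $\mathbb R^{3,3}$; it is invertible iff $x\cdot y\ne0$. The reflection with respect to an invertible $U\in\mathbb R^{3,3}$ is $V\mapsto V-2\frac{V\cdot U}{U\cdot U}U$. A linear isometry $g$ of $\mathbb R^{3,3}$ induces the map $p\mapsto Rp+t$ of $\mathbb R^3$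 (matrix $A=\begin{pmatrix} 1 & 0 \\ t & R \end{pmatrix}$ on $\mathbb R^4$ in the basis $e_0,\dots,e_3$) if for every nonzero $X\in\mathbb R^4$, $g$ maps the null 3-space $\{X\wedge Y:Y\in\mathbb R^4\}$ to $\{AX\wedge Y:Y\in\mathbb R^4\}$. *)

theory Defs
  imports "HOL-Analysis.Analysis"
begin

text \<open>
  The basis vectors $e_0, e_1, e_2, e_3$ of \<^typ>\<open>real^4\<close> are \<open>axis i 1\<close> for \<open>i = 0, 1, 2, 3\<close>
  (in the index type \<^typ>\<open>4\<close> one has \<open>0 = 4\<close>).
  A vector of $\Lambda^2(\mathbf{R}^4)$ is represented by its coordinates \<open>(x, y)\<close> with respect to
  $E_1, E_2, E_3, E_1', E_2', E_3'$.
\<close>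

type_synonym R33 = "(real^3) \<times> (real^3)"

definition wedge :: "real^4 \<Rightarrow> real^4 \<Rightarrow> R33" where
  "wedge X Y =
     (vector [X$0 * Y$1 - X$1 * Y$0, X$0 * Y$2 - X$2 * Y$0, X$0 * Y$3 - X$3 * Y$0],
      vector [X$2 * Y$3 - X$3 * Y$2, X$3 * Y$1 - X$1 * Y$3, X$1 * Y$2 - X$2 * Y$1])"

definition form33 :: "R33 \<Rightarrow> R33 \<Rightarrow> real" where
  "form33 U V = fst U \<bullet> snd V + snd U \<bullet> fst V"

definition invertible33 :: "R33 \<Rightarrow> bool" where
  "invertible33 U \<longleftrightarrow> fst U \<bullet> snd U \<noteq> 0"

definition reflection33 :: "R33 \<Rightarrow> R33 \<Rightarrow> R33" where
  "reflection33 U V = V - (2 * (form33 V U / form33 U U)) *\<^sub>R U"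

definition linear_isometry33 :: "(R33 \<Rightarrow> R33) \<Rightarrow> bool" where
  "linear_isometry33 g \<longleftrightarrow> linear g \<and> (\<forall>U V. form33 (g U) (g V) = form33 U V)"

text \<open>The identification of the nonzero indices of \<^typ>\<open>real^4\<close> with those of \<^typ>\<open>real^3\<close>;
  the value at \<open>0\<close> is irrelevant.\<close>

definition idx3 :: "4 \<Rightarrow> 3" where
  "idx3 i = (if i = 1 then 1 else if i = 2 then 2 else 3)"

definition affine_matrix :: "real^3^3 \<Rightarrow> real^3 \<Rightarrow> real^4^4" where
  "affine_matrix R t =
     (\<chi> i j. if i = 0 then (if j = 0 then 1 else 0)
             else if j = 0 then t $ idx3 i
             else R $ idx3 i $ idx3 j)"

definition induces :: "(R33 \<Rightarrow> R33) \<Rightarrow> (real^3 \<Rightarrow> real^3) \<Rightarrow> bool" where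
  "induces g f \<longleftrightarrow>
     linear_isometry33 g \<and>
     (\<exists>R t. (\<forall>p. f p = R *v p + t) \<and>
        (\<forall>X. X \<noteq> 0 \<longrightarrow>
           g ` {wedge X Y | Y. True} = {wedge (affine_matrix R t *v X) Y | Y. True}))"

definition vec_angle :: "real^3 \<Rightarrow> real^3 \<Rightarrow> real" where
  "vec_angle x y = arccos ((x \<bullet> y) / (norm x * norm y))"

text \<open>
  The rotation about the origin by the angle \<open>\<theta>\<close> in the plane spanned by linearly independent
  \<open>a\<close> and \<open>b\<close>, from \<open>a\<close> toward \<open>b\<close>: here \<open>u, w\<close> is the orthonormal basis of that plane obtained from
  \<open>a, b\<close> by Gram--Schmidt, and the orthogonal complement of the plane is fixed pointwise.
\<close>

definition plane_rotation :: "real^3 \<Rightarrow> real^3 \<Rightarrow> real \<Rightarrow> real^3 \<Rightarrow> real^3" where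
  "plane_rotation a b \<theta> p =
     (let u = sgn a; w = sgn (b - (b \<bullet> u) *\<^sub>R u) in
        (p - (p \<bullet> u) *\<^sub>R u - (p \<bullet> w) *\<^sub>R w)
        + (p \<bullet> u) *\<^sub>R (cos \<theta> *\<^sub>R u + sin \<theta> *\<^sub>R w)
        + (p \<bullet> w) *\<^sub>R (- sin \<theta> *\<^sub>R u + cos \<theta> *\<^sub>R w))"

lemma wedge_basis:
  "wedge (axis 0 1) (axis 1 1) = (axis 1 1, 0)"
  "wedge (axis 0 1) (axis 2 1) = (axis 2 1, 0)"
  "wedge (axis 0 1) (axis 3 1) = (axis 3 1, 0)"
  "wedge (axis 2 1) (axis 3 1) = (0, axis 1 1)"
  "wedge (axis 3 1) (axis 1 1) = (0, axis 2 1)"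
  "wedge (axis 1 1) (axis 2 1) = (0, axis 3 1)"
  by (simp_all add: wedge_def vec_eq_iff forall_3 axis_def)

lemma bilinear_wedge: "bilinear wedge"
  by (auto simp: bilinear_def wedge_def vec_eq_iff forall_3 algebra_simps intro!: linearI)

lemma wedge_self: "wedge X X = 0"
  by (simp add: wedge_def vec_eq_iff forall_3 prod_eq_iff)

lemma invertible33_iff: "invertible33 U \<longleftrightarrow> form33 U U \<noteq> 0"
  by (auto simp: invertible33_def form33_def inner_commute)

lemma plane_rotation_toward:
  assumes "norm a = 1" "norm b = 1" "a \<noteq> b" "independent {a, b}"
  shows "plane_rotation a b (vec_angle a b) a = b"
proof -
  define c where "c = a \<bullet> b"
  define v where "v = b - c *\<^sub>R a"
  have aa: "a \<bullet> a = 1" and bb: "b \<bullet> b = 1"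
    using assms by (simp_all add: norm_eq_1)
  have "v \<noteq> 0"
  proof
    assume "v = 0"
    then have "b \<in> span {a}"
      by (simp add: v_def span_base span_scale)
    with assms(3,4) show False
      by (metis independent_insert insert_commute singletonD)
  qed
  have vv: "v \<bullet> v = 1 - c\<^sup>2" and av: "a \<bullet> v = 0"
    by (simp_all add: v_def c_def aa bb inner_commute power2_eq_square algebra_simps)
  then have nv: "norm v = sqrt (1 - c\<^sup>2)"
    by (simp add: norm_eq_sqrt_inner)
  have c: "\<bar>c\<bar> \<le> 1"
    using Cauchy_Schwarz_ineq2[of a b] assms by (simp add: c_def)
  have "sin (arccos c) = norm v"
    using c nv by (simp add: sin_arccos_abs)
  then have s: "sin (arccos c) *\<^sub>R sgn v = v"
    using \<open>v \<noteq> 0\<close> by (simp add: sgn_div_norm)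
  have "sgn a = a"
    using assms by (simp add: sgn_div_norm)
  moreover have "a \<bullet> sgn v = 0"
    by (simp add: sgn_div_norm av)
  moreover have "cos (arccos c) = c"
    using c by (simp add: cos_arccos_abs)
  ultimately show ?thesis
    using assms s aa
    by (simp add: plane_rotation_def vec_angle_def Let_def inner_commute[of b a]
        flip: c_def v_def) (simp add: v_def)
qed

end

theory Submission
  imports Defs
begin

text \<open>
  For a unit vector \<open>x\<close>, reflecting in \<open>(x, x)\<close> and then in \<open>(x, - x)\<close> acts on both components of
  \<open>R33\<close> as the ordinary reflection \<open>reflect_along x\<close> of \<open>\<real>\<^sup>3\<close>. The four reflections therefore
  act diagonally by \<open>reflect_along x2 \<circ> reflect_along x1\<close>, which is the rotation by twice the
  angle. A rotation \<open>R\<close> preserves the cross product, and \<open>wedge\<close> is made of scalar multiples and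
  a cross product, so the diagonal action of \<open>R\<close> carries \<open>wedge X Y\<close> to \<open>wedge (A X) (A Y)\<close>.
\<close>

definition spatial :: "real^4 \<Rightarrow> real^3" where
  "spatial X = vector [X$1, X$2, X$3]"

text \<open>\<open>forall_4\<close> and \<open>sum_4\<close> write the index of e_0 as
  \<open>4\<close>, whereas \<open>wedge\<close> and \<open>affine_matrix\<close> write it as
  \<open>0\<close>; in the type \<open>4\<close> the two numerals coincide.\<close>

lemma vec4_nth_4: "X$4 = X$0" for X :: "real^4"
  by (rule arg_cong[where f = "($) X"]) simp

lemma vec4_eq_iff: "X = Y \<longleftrightarrow> X$0 = Y$0 \<and> spatial X = spatial Y" for X Y :: "real^4"
  by (auto simp: vec_eq_iff forall_3 forall_4 spatial_def vec4_nth_4)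

lemma wedge_eq_cross3:
  "wedge X Y = (X$0 *\<^sub>R spatial Y - Y$0 *\<^sub>R spatial X, cross3 (spatial X) (spatial Y))"
  by (simp add: wedge_def spatial_def cross3_def vec_eq_iff forall_3)

lemma affine_matrix_mult_0: "(affine_matrix R t *v X) $ 0 = X$0"
  by (simp add: matrix_vector_mult_def affine_matrix_def sum_4 vec4_nth_4)

lemma spatial_affine_matrix_mult:
  "spatial (affine_matrix R t *v X) = X$0 *\<^sub>R t + R *v spatial X"
  by (simp add: spatial_def matrix_vector_mult_def affine_matrix_def sum_4 sum_3
      vec_eq_iff forall_3 idx3_def vec4_nth_4)

lemma affine_matrix_inverse:
  assumes "R ** S = mat 1"
  shows "affine_matrix R 0 *v (affine_matrix S 0 *v X) = X"
  using assms
  unfolding vec4_eq_iff affine_matrix_mult_0 spatial_affine_matrix_mult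
  by (simp add: matrix_vector_mul_assoc)

text \<open>Determinant 1 matters here: an orthogonal matrix of determinant -1 would reverse the
  sign of the cross product in the second component.\<close>

lemma wedge_affine_rotation:
  assumes "rotation_matrix R"
  shows "wedge (affine_matrix R 0 *v X) (affine_matrix R 0 *v Y) =
         map_prod ((*v) R) ((*v) R) (wedge X Y)"
  using assms
  by (simp add: wedge_eq_cross3 affine_matrix_mult_0 spatial_affine_matrix_mult
      cross_rotation_matrix matrix_vector_mult_diff_distrib matrix_vector_mult_scaleR)

text \<open>\<open>form33\<close> only adds inner products of a first with a second component, and
  \<open>f\<close> preserves each of them.\<close>

lemma linear_isometry33_map_prod:
  assumes "orthogonal_transformation f"
  shows "linear_isometry33 (map_prod f f)"
proof -
  have "linear f"
    using assms by (simp add: orthogonal_transformation_def)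
  then have "linear (map_prod f f)"
    by (auto intro!: linearI simp: linear_add linear_scale)
  then show ?thesis
    using assms by (simp add: linear_isometry33_def form33_def orthogonal_transformation_def)
qed

lemma induces_rotation:
  assumes "rotation_matrix R"
  shows "induces (map_prod ((*v) R) ((*v) R)) ((*v) R)"
proof -
  let ?g = "map_prod ((*v) R) ((*v) R)" and ?A = "affine_matrix R 0"
  have R: "orthogonal_matrix R"
    using assms by (simp add: rotation_matrix_def)
  then have "R ** transpose R = mat 1"
    by (simp add: orthogonal_matrix_def)
  then have inv: "?A *v (affine_matrix (transpose R) 0 *v Y) = Y" for Y
    by (rule affine_matrix_inverse)
  have "?g ` {wedge X Y | Y. True} = {wedge (?A *v X) Y | Y. True}" for X
  proof (intro equalityI subsetI)
    fix V assume "V \<in> ?g ` {wedge X Y | Y. True}"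
    then show "V \<in> {wedge (?A *v X) Y | Y. True}"
      using wedge_affine_rotation[OF assms] by (smt (verit) imageE mem_Collect_eq)
  next
    fix V assume "V \<in> {wedge (?A *v X) Y | Y. True}"
    then obtain Y where "V = wedge (?A *v X) Y" by blast
    \<comment> \<open>The preimage comes from applying the inverse of \<open>?A\<close> to
      \<open>Y\<close>; orthogonality of \<open>R\<close> makes \<open>transpose R\<close> provide
      it.\<close>
    then have "V = ?g (wedge X (affine_matrix (transpose R) 0 *v Y))"
      by (simp add: inv flip: wedge_affine_rotation[OF assms])
    then show "V \<in> ?g ` {wedge X Y | Y. True}" by blast
  qed
  moreover have "linear_isometry33 ?g"
    using R by (intro linear_isometry33_map_prod)
      (simp add: orthogonal_transformation_matrix)
  ultimately show ?thesis
    \<comment> \<open>The translation part is \<open>t = 0\<close>.\<close>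
    unfolding induces_def by (metis add.right_neutral)
qed

text \<open>This is a reflection only for unit vectors \<open>x\<close>.\<close>

definition reflect_along :: "'a::real_inner \<Rightarrow> 'a \<Rightarrow> 'a" where
  "reflect_along x p = p - (2 * (p \<bullet> x)) *\<^sub>R x"

text \<open>The vectors \<open>(x, x)\<close> and \<open>(x, - x)\<close> are orthogonal for
  \<open>form33\<close>, with squares 2 and -2. Hence the composition is -1 on their span, which
  consists of all pairs of multiples of \<open>x\<close>, and the identity on the pairs of vectors
  perpendicular to \<open>x\<close>.\<close>

lemma reflection33_pair:
  assumes "norm x = 1"
  shows "reflection33 (x, - x) \<circ> reflection33 (x, x) =
         map_prod (reflect_along x) (reflect_along x)"
proof
  fix V :: R33
  obtain a b where V: "V = (a, b)" by fastforce
  have x: "x \<bullet> x = 1"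
    using assms by (simp add: norm_eq_1)
  have "reflection33 (x, x) (a, b) =
      (a - (a \<bullet> x + b \<bullet> x) *\<^sub>R x, b - (a \<bullet> x + b \<bullet> x) *\<^sub>R x)" for a b
    by (simp add: reflection33_def form33_def x inner_commute)
  moreover have "reflection33 (x, - x) (a, b) =
      (a + (b \<bullet> x - a \<bullet> x) *\<^sub>R x, b - (b \<bullet> x - a \<bullet> x) *\<^sub>R x)" for a b
    by (simp add: reflection33_def form33_def x inner_commute)
  ultimately show "(reflection33 (x, - x) \<circ> reflection33 (x, x)) V =
      map_prod (reflect_along x) (reflect_along x) V"
    by (simp add: V reflect_along_def x inner_diff_left)
      (simp add: scaleR_2 algebra_simps flip: scaleR_scaleR)
qed

lemma linear_reflect_along: "linear (reflect_along x)"
  by (auto intro!: linearI simp: reflect_along_def algebra_simps)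

lemma orthogonal_transformation_reflect_along:
  assumes "norm x = 1"
  shows "orthogonal_transformation (reflect_along x)"
proof -
  have "x \<bullet> x = 1"
    using assms by (simp add: norm_eq_1)
  then show ?thesis
    by (simp add: orthogonal_transformation_def linear_reflect_along reflect_along_def
        inner_commute algebra_simps)
qed

text \<open>This is the determinant of the rank-one update I - 2 x x^T of the identity; it equals -1
  for a unit vector.\<close>

lemma det_matrix_reflect_along: "det (matrix (reflect_along x)) = 1 - 2 * (x \<bullet> x)" for x :: "real^3"
  by (simp add: det_3 matrix_def reflect_along_def inner_axis' inner_vec_def sum_3 axis_def
      algebra_simps)

lemma rotation_matrix_reflect_along_compose:
  fixes x y :: "real^3"
  assumes "norm x = 1" "norm y = 1"
  shows "rotation_matrix (matrix (reflect_along x \<circ> reflect_along y))"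
proof -
  have "orthogonal_matrix (matrix (reflect_along z))"
    and "det (matrix (reflect_along z)) = - 1" if "norm z = 1" for z :: "real^3"
    using that orthogonal_transformation_reflect_along[of z]
    by (simp_all add: orthogonal_transformation_matrix det_matrix_reflect_along norm_eq_1)
  then show ?thesis
    using assms
    by (simp add: rotation_matrix_def matrix_compose linear_reflect_along det_mul
        orthogonal_matrix_mul)
qed

lemma reflect_along_compose_eq_plane_rotation:
  assumes "norm x1 = 1" "norm x2 = 1"
  shows "reflect_along x2 \<circ> reflect_along x1 = plane_rotation x1 x2 (2 * vec_angle x1 x2)"
proof
  fix p
  define c where "c = x1 \<bullet> x2"
  define v where "v = x2 - c *\<^sub>R x1"
  define w where "w = sgn v"
  define s where "s = norm v"
  have unit: "x1 \<bullet> x1 = 1" "x2 \<bullet> x2 = 1"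
    using assms by (simp_all add: norm_eq_1)
  have v: "v = s *\<^sub>R w"
    by (cases "v = 0") (simp_all add: s_def w_def sgn_div_norm)
  have s2: "s\<^sup>2 = 1 - c\<^sup>2"
    unfolding s_def power2_norm_eq_inner v_def c_def
    by (simp add: unit inner_commute power2_eq_square algebra_simps)
  have c: "\<bar>c\<bar> \<le> 1"
    using Cauchy_Schwarz_ineq2[of x1 x2] assms by (simp add: c_def)
  have ang: "vec_angle x1 x2 = arccos c"
    using assms by (simp add: vec_angle_def c_def)
  have "s \<ge> 0" by (simp add: s_def)
  then have "sin (arccos c) = s"
    using c s2 by (simp add: sin_arccos_abs flip: s2)
  \<comment> \<open>With the cosine in the form \<open>1 - 2 * s\<^sup>2\<close>, its 1 restores the
    components of \<open>p\<close> that \<open>plane_rotation\<close> subtracts first.\<close>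
  then have trig: "cos (2 * arccos c) = 1 - 2 * s\<^sup>2" "sin (2 * arccos c) = 2 * s * c"
    using c by (simp_all add: cos_double_sin sin_double cos_arccos_abs)
  have "sgn x1 = x1"
    using assms by (simp add: sgn_div_norm)
  then have "plane_rotation x1 x2 (2 * vec_angle x1 x2) p =
      p - (p \<bullet> x1) *\<^sub>R x1 - (p \<bullet> w) *\<^sub>R w
        + (p \<bullet> x1) *\<^sub>R ((1 - 2 * s\<^sup>2) *\<^sub>R x1 + (2 * s * c) *\<^sub>R w)
        + (p \<bullet> w) *\<^sub>R (- (2 * s * c) *\<^sub>R x1 + (1 - 2 * s\<^sup>2) *\<^sub>R w)"
    by (simp add: plane_rotation_def Let_def ang trig inner_commute[of x2 x1] w_def
        flip: c_def v_def)
  \<comment> \<open>Each \<open>w\<close> is paired with a factor \<open>s\<close>, so that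
    \<open>v\<close> can replace \<open>s *\<^sub>R w\<close> and no normalization remains.\<close>
  also have "\<dots> = p + (p \<bullet> x1) *\<^sub>R (- (2 * s\<^sup>2) *\<^sub>R x1 + (2 * c) *\<^sub>R (s *\<^sub>R w))
        - (2 * c * (p \<bullet> (s *\<^sub>R w))) *\<^sub>R x1 - (2 * (p \<bullet> (s *\<^sub>R w))) *\<^sub>R (s *\<^sub>R w)"
    by (simp add: algebra_simps power2_eq_square)
  also have "\<dots> = p + (p \<bullet> x1) *\<^sub>R (- (2 * (1 - c\<^sup>2)) *\<^sub>R x1 + (2 * c) *\<^sub>R v)
        - (2 * c * (p \<bullet> v)) *\<^sub>R x1 - (2 * (p \<bullet> v)) *\<^sub>R v"
    by (simp only: v s2)
  also have "\<dots> = p - (2 * (p \<bullet> x1)) *\<^sub>R x1 - (2 * (p \<bullet> x2 - 2 * c * (p \<bullet> x1))) *\<^sub>R x2"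
    by (simp add: v_def vec_eq_iff inner_diff_right power2_eq_square) (simp add: algebra_simps)
  also have "\<dots> = (reflect_along x2 \<circ> reflect_along x1) p"
    by (simp add: reflect_along_def unit c_def algebra_simps)
  finally show "(reflect_along x2 \<circ> reflect_along x1) p =
      plane_rotation x1 x2 (2 * vec_angle x1 x2) p" ..
qed

theorem proposition25:
  fixes x1 x2 :: "real^3"
  assumes "norm x1 = 1" and "norm x2 = 1"
    and "x1 \<noteq> x2" and "independent {x1, x2}"
  shows "invertible33 (x1, x1) \<and> invertible33 (x1, - x1) \<and>
         invertible33 (x2, x2) \<and> invertible33 (x2, - x2) \<and>
         induces
           (reflection33 (x2, - x2) \<circ> reflection33 (x2, x2) \<circ>
            reflection33 (x1, - x1) \<circ> reflection33 (x1, x1))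
           (plane_rotation x1 x2 (2 * vec_angle x1 x2))"
proof -
  have nz: "x1 \<noteq> 0" "x2 \<noteq> 0"
    using assms by auto
  define f :: "real^3 \<Rightarrow> real^3" where "f = reflect_along x2 \<circ> reflect_along x1"
  \<comment> \<open>Linearity lets \<open>f\<close> be recovered from its matrix, the form in which
    \<open>induces_rotation\<close> applies.\<close>
  have "linear f"
    unfolding f_def by (intro linear_compose linear_reflect_along)
  then have f: "(*v) (matrix f) = f"
    by (simp add: fun_eq_iff)
  have "reflection33 (x2, - x2) \<circ> reflection33 (x2, x2) \<circ>
      reflection33 (x1, - x1) \<circ> reflection33 (x1, x1) = map_prod f f"
    using assms(1,2) by (simp add: f_def comp_assoc reflection33_pair map_prod.comp)
  moreover have "induces (map_prod f f) f"
    using induces_rotation[OF rotation_matrix_reflect_along_compose[OF assms(2,1)]]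
    by (simp add: f flip: f_def)
  ultimately show ?thesis
    using assms nz
    by (simp add: invertible33_def f_def reflect_along_compose_eq_plane_rotation)
qed

end
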